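(* Let $A=\{E_j\}_{j=1}^N$ be any finite set of (distinct) points in $(-2,2)$ with $0\notin A+A$, and let $\{\theta_j\}_{j=1}^N\subset[0,\pi]$. Then there exist potentials $V:\mathbb{N}\to\mathbb{R}$ with $V(n)=\frac{O(1)}{1+n}$ such that for each $E_j\in A$ the equation $$u(n+1)+u(n-1)+V(n)u(n)=E_ju(n)\qquad(n\ge1)$$ has a nontrivial $\ell^2(\mathbb{N})$ solution with boundary condition $\frac{u(1)}{u(0)}=\tan\theta_j$.
   Context: Here $\mathbb{N}=\{1,2,\dots\}$. For a set $A\subset\mathbb{R}$, $A+A=\{x+y: x\in A,\ y\in A\}$ (with $x=y$ allowed). $V(n)=\frac{O(1)}{1+n}$ means there is a constant $C$ with $|V(n)|\le\frac{C}{1+n}$ for all $n$. The boundary condition $\frac{u(1)}{u(0)}=\tan\theta_j$ means $u(1)\cos\theta_j=u(0)\sin\theta_j$. *)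

theory Defs
  imports Complex_Main "HOL-Library.Set_Algebras" "HOL-Analysis.Infinite_Sum"
begin

text \<open>
  The half-line sites are n = 1, 2, 3, \<dots>; a solution u additionally carries the boundary value
  u 0. A potential is a function on nat whose value at 0 plays no role.
\<close>

definition inverse_linear_decay :: "(nat \<Rightarrow> real) \<Rightarrow> bool" where
  "inverse_linear_decay V \<longleftrightarrow> (\<exists>C. \<forall>n\<ge>1. \<bar>V n\<bar> \<le> C / (1 + real n))"

definition schroedinger_solution :: "(nat \<Rightarrow> real) \<Rightarrow> real \<Rightarrow> (nat \<Rightarrow> real) \<Rightarrow> bool" where
  "schroedinger_solution V e u \<longleftrightarrow>
     (\<forall>n\<ge>1. u (n + 1) + u (n - 1) + V n * u n = e * u n)"

definition square_summable :: "(nat \<Rightarrow> real) \<Rightarrow> bool" where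
  "square_summable u \<longleftrightarrow> (\<lambda>n. (u n)\<^sup>2) summable_on {1..}"

text \<open>
  The condition u(1) / u(0) = tan \<theta>, cleared of denominators so that it also makes sense for
  u(0) = 0, i.e. for \<theta> = pi / 2.
\<close>

definition boundary_condition :: "real \<Rightarrow> (nat \<Rightarrow> real) \<Rightarrow> bool" where
  "boundary_condition \<theta> u \<longleftrightarrow> u 1 * cos \<theta> = u 0 * sin \<theta>"

end

theory Submission
  imports Defs "HOL-Analysis.Harmonic_Numbers"
begin

text \<open>
  Write \<open>E = 2 cos k = w + cnj w\<close> with \<open>w = exp (\<i> k)\<close> in the upper half plane, and encode a real
  solution \<open>u\<close> by the complex amplitude \<open>y n = cnj w * u n - u (n - 1)\<close>, so that
  \<open>u n = - Im (y n) / Im w\<close>.  In these coordinates the free equation is the rotation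
  \<open>y (n + 1) = cnj w * y n\<close>, and the potential perturbs it to
  \<open>y (n + 1) = cnj w * (y n + V n / Im w * Im (y n))\<close>.  With the phase \<open>\<zeta> n = (sgn (y n))\<^sup>2\<close>
  this gives, up to terms of order \<open>(V n)\<^sup>2\<close>, the growth law
  \<open>\<bar>y (n + 1)\<bar>\<^sup>2 = \<bar>y n\<bar>\<^sup>2 * (1 + V n / Im w * Im (\<zeta> n))\<close>.

  The potential is chosen by feedback, from all the solutions at once:
  \<open>V n = - (4 / n) * (\<Sum>i. Im (\<zeta>\<^sub>i n))\<close>, where \<open>\<zeta>\<^sub>i\<close> is the phase of the \<open>i\<close>-th solution under this same
  \<open>V\<close>.  It is trivially \<open>O(1/n)\<close>.  The logarithm of \<open>\<bar>y\<^sub>j\<bar>\<^sup>2\<close> then changes at step \<open>n\<close> by at most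
  \<open>- (4 / (n Im w\<^sub>j)) * (\<Sum>i. Im (\<zeta>\<^sub>i n) * Im (\<zeta>\<^sub>j n))\<close> up to a summable error.  Since
  \<open>2 * Im a * Im b = Re (a * cnj b) - Re (a * b)\<close>, the term \<open>i = j\<close> has the mean value \<open>1/2\<close>, and what
  remains consists of the products \<open>\<zeta>\<^sub>i * cnj \<zeta>\<^sub>j\<close> for \<open>i \<noteq> j\<close> and \<open>\<zeta>\<^sub>i * \<zeta>\<^sub>j\<close> for all \<open>i\<close>.  They rotate,
  up to an error \<open>O(1/n)\<close>, by the fixed factors \<open>(cnj w\<^sub>i * w\<^sub>j)\<^sup>2\<close> and \<open>(cnj w\<^sub>i * cnj w\<^sub>j)\<^sup>2\<close>.  These
  differ from \<open>1\<close> precisely because the energies are distinct and no two of them, equal or not,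
  add up to \<open>0\<close>.  Hence summation by parts (\<open>almost_rotating_imp_bounded_sums\<close>) shows that they
  contribute only a bounded amount, and \<open>\<bar>y\<^sub>j n\<bar>\<^sup>2\<close> is bounded by a multiple of
  \<open>exp (- 2 * harm n)\<close>, that is, of \<open>1 / n\<^sup>2\<close> (\<open>y_decay\<close>).  The initial data of every solution are
  free, so that every boundary condition can be imposed.
\<close>

section \<open>Sequences that almost rotate\<close>

definition almost_rotating :: "complex \<Rightarrow> (nat \<Rightarrow> complex) \<Rightarrow> bool" where
  "almost_rotating q P \<longleftrightarrow> norm q = 1 \<and> (\<forall>n. norm (P n) = 1) \<and>
     (\<exists>K. \<forall>n\<ge>1. norm (P (Suc n) - q * P n) \<le> K / real n)"

lemma norm_mult_diff_mult_le:
  fixes a b c d :: complex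
  assumes "norm b = 1" "norm c = 1"
  shows "norm (a * b - c * d) \<le> norm (a - c) + norm (b - d)"
proof -
  have "a * b - c * d = (a - c) * b + c * (b - d)"
    by (simp add: algebra_simps)
  also have "norm \<dots> \<le> norm ((a - c) * b) + norm (c * (b - d))"
    by (rule norm_triangle_ineq)
  finally show ?thesis
    using assms by (simp add: norm_mult)
qed

lemma almost_rotating_mult:
  assumes "almost_rotating p P" "almost_rotating q Q"
  shows "almost_rotating (p * q) (\<lambda>n. P n * Q n)"
proof -
  obtain K L where
    K: "\<And>n. n \<ge> 1 \<Longrightarrow> norm (P (Suc n) - p * P n) \<le> K / real n" and
    L: "\<And>n. n \<ge> 1 \<Longrightarrow> norm (Q (Suc n) - q * Q n) \<le> L / real n" and
    unit: "norm p = 1" "norm q = 1" "\<And>n. norm (P n) = 1" "\<And>n. norm (Q n) = 1"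
    using assms unfolding almost_rotating_def by blast
  have "norm (P (Suc n) * Q (Suc n) - p * q * (P n * Q n)) \<le> (K + L) / real n" if "n \<ge> 1" for n
  proof -
    have "norm (P (Suc n) * Q (Suc n) - p * P n * (q * Q n))
        \<le> norm (P (Suc n) - p * P n) + norm (Q (Suc n) - q * Q n)"
      by (rule norm_mult_diff_mult_le) (simp_all add: norm_mult unit)
    also have "\<dots> \<le> K / real n + L / real n"
      using K[OF that] L[OF that] by (rule add_mono)
    finally show ?thesis
      by (simp add: add_divide_distrib mult_ac)
  qed
  then show ?thesis
    unfolding almost_rotating_def using unit by (auto simp: norm_mult)
qed

lemma almost_rotating_cnj:
  assumes "almost_rotating q P"
  shows "almost_rotating (cnj q) (\<lambda>n. cnj (P n))"
proof -
  have "norm (cnj (P (Suc n)) - cnj q * cnj (P n)) = norm (P (Suc n) - q * P n)" for n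
    by (metis complex_cnj_diff complex_cnj_mult complex_mod_cnj)
  with assms show ?thesis
    by (simp add: almost_rotating_def)
qed

lemma sum_inverse_squares_le: "(\<Sum>m=1..n. 1 / (real m)\<^sup>2) \<le> 2"
proof (cases "n = 0")
  case False
  then have "n \<ge> 1"
    by simp
  then have "(\<Sum>m=1..n. 1 / (real m)\<^sup>2) \<le> 2 - 1 / real n"
  proof (induction n rule: nat_induct_at_least)
    case (Suc n)
    then have "(\<Sum>m=1..Suc n. 1 / (real m)\<^sup>2) \<le> 2 - 1 / real n + 1 / (real (Suc n))\<^sup>2"
      by simp
    also have "\<dots> \<le> 2 - 1 / real (Suc n)"
      using Suc.hyps by (simp add: divide_simps power2_eq_square) (simp add: algebra_simps)
    finally show ?case .
  qed simp
  also have "\<dots> \<le> 2"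
    by simp
  finally show ?thesis .
qed simp

text \<open>
  Summation by parts: as \<open>(1 - q) * P m\<close> is close to \<open>P m - P (m + 1)\<close>, the sum with weights
  \<open>1 / m\<close> telescopes up to an error of order \<open>1 / m\<^sup>2\<close>.
\<close>

lemma almost_rotating_imp_bounded_sums:
  assumes "almost_rotating q P" "q \<noteq> 1"
  shows "\<exists>M. \<forall>n. norm (\<Sum>m=1..n. P m / of_nat m) \<le> M"
proof -
  obtain K where K: "\<And>n. n \<ge> 1 \<Longrightarrow> norm (P (Suc n) - q * P n) \<le> K / real n"
    and unit: "\<And>n. norm (P n) = 1"
    using assms(1) unfolding almost_rotating_def by blast
  have "K \<ge> 0"
    using order_trans[OF norm_ge_zero K[of 1]] by simp
  define r where "r m = (P (Suc m) - q * P m) / of_nat m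
                        - P (Suc m) / of_nat (m * Suc m)" for m
  have norm_r: "norm (r m) \<le> (K + 1) * (1 / (real m)\<^sup>2)" if "m \<ge> 1" for m
  proof -
    have "norm (r m) \<le> norm ((P (Suc m) - q * P m) / of_nat m)
                        + norm (P (Suc m) / of_nat (m * Suc m))"
      unfolding r_def by (rule norm_triangle_ineq4)
    also have "\<dots> = norm (P (Suc m) - q * P m) / real m + 1 / (real m * real (Suc m))"
      by (simp only: norm_divide norm_mult norm_of_nat unit of_nat_mult)
    also have "\<dots> \<le> (K / real m) / real m + 1 / (real m * real m)"
      using K[OF that] that by (intro add_mono divide_right_mono divide_left_mono) auto
    finally show ?thesis
      by (simp add: power2_eq_square add_divide_distrib)
  qed
  have step: "(1 - q) * (P m / of_nat m)
      = P m / of_nat m - P (Suc m) / of_nat (Suc m) + r m" if "m \<ge> 1" for m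
  proof -
    have "(of_nat m :: complex) \<noteq> 0" "(1 + of_nat m :: complex) \<noteq> 0"
      using that by (simp_all add: complex_eq_iff)
    then have "P (Suc m) / of_nat (m * Suc m) = P (Suc m) / of_nat m - P (Suc m) / of_nat (Suc m)"
      by (simp add: field_simps)
    then show ?thesis
      by (simp add: r_def diff_divide_distrib left_diff_distrib)
  qed
  have telescope: "(\<Sum>m=1..n. P m / of_nat m - P (Suc m) / of_nat (Suc m))
      = P 1 - P (Suc n) / of_nat (Suc n)" for n
    by (induction n) simp_all
  have "norm (\<Sum>m=1..n. P m / of_nat m) \<le> (2 + (K + 1) * 2) / norm (1 - q)" for n
  proof -
    have "(1 - q) * (\<Sum>m=1..n. P m / of_nat m)
        = P 1 - P (Suc n) / of_nat (Suc n) + (\<Sum>m=1..n. r m)"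
      unfolding sum_distrib_left telescope[symmetric] sum.distrib[symmetric]
      by (rule sum.cong) (use step in auto)
    also have "norm \<dots> \<le> norm (P 1) + norm (P (Suc n) / of_nat (Suc n)) + norm (\<Sum>m=1..n. r m)"
      by (meson add_right_mono norm_triangle_ineq norm_triangle_ineq4 order_trans)
    also have "norm (P (Suc n) / of_nat (Suc n)) \<le> 1"
      by (simp only: norm_divide norm_of_nat unit) simp
    also have "norm (\<Sum>m=1..n. r m) \<le> (\<Sum>m=1..n. (K + 1) * (1 / (real m)\<^sup>2))"
      by (rule sum_norm_le) (use norm_r in auto)
    also have "\<dots> \<le> (K + 1) * 2"
      unfolding sum_distrib_left[symmetric]
      using sum_inverse_squares_le \<open>K \<ge> 0\<close> by (intro mult_left_mono) auto
    finally have "norm (1 - q) * norm (\<Sum>m=1..n. P m / of_nat m) \<le> 2 + (K + 1) * 2"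
      by (simp add: norm_mult unit)
    then show ?thesis
      using \<open>q \<noteq> 1\<close> by (simp add: pos_le_divide_eq mult.commute)
  qed
  then show ?thesis
    by blast
qed

lemma of_real_norm_mult_sgn: "of_real (norm z) * sgn z = z" for z :: complex
  by (cases "z = 0") (simp_all add: sgn_div_norm scaleR_conv_of_real)

lemma norm_sgn_add_diff_sgn_le:
  fixes y d :: complex
  assumes "y \<noteq> 0" "y + d \<noteq> 0"
  shows "norm (sgn (y + d) - sgn y) \<le> 2 * norm d / norm y"
proof -
  have "norm y * norm (sgn (y + d) - sgn y)
      = norm (of_real (norm y) * (sgn (y + d) - sgn y))"
    by (simp add: norm_mult)
  also have "of_real (norm y) * (sgn (y + d) - sgn y)
      = (of_real (norm y) - of_real (norm (y + d))) * sgn (y + d) + d"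
    by (simp only: left_diff_distrib right_diff_distrib of_real_norm_mult_sgn) simp
  also have "norm \<dots> \<le> \<bar>norm y - norm (y + d)\<bar> * 1 + norm d"
    using assms
    by (intro order_trans[OF norm_triangle_ineq] add_mono)
       (simp_all add: norm_mult norm_sgn flip: of_real_diff)
  also have "\<dots> \<le> 2 * norm d"
    using norm_triangle_ineq3[of y "y + d"] by simp
  finally show ?thesis
    using assms by (simp add: field_simps)
qed

section \<open>The resonant feedback potential\<close>

text \<open>
  The numbers \<open>w j\<close> are the Floquet multipliers of the energies \<open>2 * Re (w j)\<close>, and \<open>x j\<close> is the
  initial amplitude of the corresponding solution.
\<close>

locale resonant_feedback =
  fixes J :: "'j set" and w x :: "'j \<Rightarrow> complex"
  assumes finite_J: "finite J"
    and norm_w: "\<And>j. j \<in> J \<Longrightarrow> norm (w j) = 1"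
    and Im_w_pos: "\<And>j. j \<in> J \<Longrightarrow> Im (w j) > 0"
    and x_nonzero: "\<And>j. j \<in> J \<Longrightarrow> x j \<noteq> 0"
    and inj_w: "inj_on w J"
    and nonresonant: "\<And>i j. i \<in> J \<Longrightarrow> j \<in> J \<Longrightarrow> Re (w i) + Re (w j) \<noteq> 0"
begin

text \<open>
  At \<open>n = 0\<close> the division by zero makes the potential vanish, so that the first step is the free
  one and the amplitude \<open>x j\<close> at site \<open>0\<close> encodes the boundary values.  The factor \<open>4\<close> is what
  yields the decay rate \<open>1 / n\<^sup>2\<close> of the squared amplitudes.
\<close>

definition feedback :: "nat \<Rightarrow> ('j \<Rightarrow> complex) \<Rightarrow> real" where
  "feedback n z = - (4 / real n) * (\<Sum>i\<in>J. Im ((sgn (z i))\<^sup>2))"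

primrec y :: "nat \<Rightarrow> 'j \<Rightarrow> complex" where
  "y 0 = x"
| "y (Suc n) = (\<lambda>j. cnj (w j) *
     (y n j + of_real (feedback n (y n) / Im (w j) * Im (y n j))))"

definition V :: "nat \<Rightarrow> real" where
  "V n = feedback n (y n)"

definition \<zeta> :: "'j \<Rightarrow> nat \<Rightarrow> complex" where
  "\<zeta> j n = (sgn (y n j))\<^sup>2"

definition u :: "'j \<Rightarrow> nat \<Rightarrow> real" where
  "u j n = - Im (y n j) / Im (w j)"

lemma y_Suc: "y (Suc n) j = cnj (w j) * (y n j + of_real (V n / Im (w j) * Im (y n j)))"
  by (simp add: V_def)

declare y.simps(2) [simp del]

lemma V_eq: "V n = - (4 / real n) * (\<Sum>i\<in>J. Im (\<zeta> i n))"
  by (simp add: V_def feedback_def \<zeta>_def)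

lemma V_0 [simp]: "V 0 = 0"
  by (simp add: V_eq)

lemma w_nonzero: "j \<in> J \<Longrightarrow> w j \<noteq> 0"
  using norm_w by force

lemma w_mult_cnj: "j \<in> J \<Longrightarrow> w j * cnj (w j) = 1"
  using norm_w by (simp add: complex_norm_square[symmetric])

text \<open>
  One step of the evolution is invertible, since the perturbation is real and vanishes together
  with the imaginary part of the amplitude.
\<close>

lemma perturbed_nonzero: "y n j + of_real (c * Im (y n j)) \<noteq> 0" if "y n j \<noteq> 0"
  using that by (auto simp: complex_eq_iff)

lemma y_nonzero: "y n j \<noteq> 0" if "j \<in> J"
proof (induction n)
  case 0
  show ?case
    using x_nonzero[OF that] by simp
next
  case (Suc n)
  then show ?case
    unfolding y_Suc mult_eq_0_iff using perturbed_nonzero[of n j "V n / Im (w j)"] w_nonzero[OF that] by simp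
qed

lemma norm_\<zeta>: "j \<in> J \<Longrightarrow> norm (\<zeta> j n) = 1"
  by (simp add: \<zeta>_def norm_power norm_sgn y_nonzero)

lemma abs_V_le: "\<bar>V n\<bar> \<le> 4 * real (card J) / real n"
proof -
  have "\<bar>\<Sum>i\<in>J. Im (\<zeta> i n)\<bar> \<le> (\<Sum>i\<in>J. 1)"
    by (rule order_trans[OF sum_abs sum_mono]) (metis abs_Im_le_cmod norm_\<zeta>)
  then have "4 / real n * \<bar>\<Sum>i\<in>J. Im (\<zeta> i n)\<bar> \<le> 4 / real n * real (card J)"
    by (intro mult_left_mono) auto
  then show ?thesis
    by (simp add: V_eq abs_mult)
qed

lemma inverse_linear_decay_V: "inverse_linear_decay V"
proof -
  have "\<bar>V n\<bar> \<le> 8 * real (card J) / (1 + real n)" if "n \<ge> 1" for n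
  proof -
    have "4 * real (card J) / real n \<le> 8 * real (card J) / (1 + real n)"
      using that mult_left_mono[of 1 "real n" "real (card J)"] by (simp add: field_simps)
    with abs_V_le[of n] show ?thesis
      by (rule order_trans)
  qed
  then show ?thesis
    unfolding inverse_linear_decay_def by blast
qed

text \<open>
  Up to the common factor \<open>- 1 / Im (w j)\<close>, the neighbours \<open>u j (n - 1)\<close> and
  \<open>u j (n + 1) + V n * u j n\<close> are the imaginary parts of \<open>w j * y n j\<close> and of
  \<open>cnj (w j) * y n j\<close>; the two rotations add up to the multiplication by \<open>2 * Re (w j)\<close>.
\<close>

lemma u_solution:
  assumes "j \<in> J"
  shows "schroedinger_solution V (2 * Re (w j)) (u j)"
  unfolding schroedinger_solution_def
proof (intro allI impI)
  fix n :: nat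
  assume "n \<ge> 1"
  then obtain m where n: "n = Suc m"
    by (cases n) auto
  have s: "Im (w j) \<noteq> 0"
    using Im_w_pos[OF assms] by simp
  have "w j * y n j = (w j * cnj (w j)) * (y m j + of_real (V m / Im (w j) * Im (y m j)))"
    by (simp add: n y_Suc)
  then have "Im (y m j) = Im (w j * y n j)"
    by (simp add: w_mult_cnj[OF assms])
  moreover have "Im (y (Suc n) j) = Im (cnj (w j) * y n j) - V n * Im (y n j)"
    using s by (simp add: y_Suc field_simps)
  ultimately have "Im (y (Suc n) j) + Im (y m j) + V n * Im (y n j) = 2 * Re (w j) * Im (y n j)"
    by simp
  moreover have "u j (n + 1) + u j (n - 1) + V n * u j n
      = - (Im (y (Suc n) j) + Im (y m j) + V n * Im (y n j)) / Im (w j)"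
    by (simp add: u_def n diff_divide_distrib)
  ultimately show "u j (n + 1) + u j (n - 1) + V n * u j n = 2 * Re (w j) * u j n"
    by (simp add: u_def)
qed

lemma u_0: "u j 0 = - Im (x j) / Im (w j)"
  by (simp add: u_def)

lemma u_1: "u j 1 = - Im (cnj (w j) * x j) / Im (w j)"
  by (simp add: u_def y_Suc)

section \<open>Decay of the amplitudes\<close>

lemma almost_rotating_\<zeta>:
  assumes j: "j \<in> J"
  shows "almost_rotating ((cnj (w j))\<^sup>2) (\<zeta> j)"
proof -
  have "norm (\<zeta> j (Suc n) - (cnj (w j))\<^sup>2 * \<zeta> j n) \<le> (16 * real (card J) / Im (w j)) / real n" for n
  proof -
    define d where "d = complex_of_real (V n / Im (w j) * Im (y n j))"
    have nz: "y n j \<noteq> 0" "y n j + d \<noteq> 0"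
      unfolding d_def by (rule y_nonzero[OF j] perturbed_nonzero)+
    have "norm d \<le> \<bar>V n\<bar> / Im (w j) * norm (y n j)"
      unfolding d_def using Im_w_pos[OF j] abs_Im_le_cmod[of "y n j"]
      by (simp add: norm_mult norm_divide divide_right_mono mult_left_mono)
    then have d_le: "norm d / norm (y n j) \<le> \<bar>V n\<bar> / Im (w j)"
      using nz by (simp add: pos_divide_le_eq)
    have "sgn (cnj (w j)) = cnj (w j)"
      using norm_w[OF j] by (simp add: sgn_div_norm)
    then have "\<zeta> j (Suc n) - (cnj (w j))\<^sup>2 * \<zeta> j n
        = (cnj (w j))\<^sup>2 * ((sgn (y n j + d))\<^sup>2 - (sgn (y n j))\<^sup>2)"
      unfolding \<zeta>_def y_Suc d_def[symmetric] sgn_mult by (simp add: power_mult_distrib algebra_simps)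
    then have "norm (\<zeta> j (Suc n) - (cnj (w j))\<^sup>2 * \<zeta> j n)
        = norm (sgn (y n j + d) * sgn (y n j + d) - sgn (y n j) * sgn (y n j))"
      by (simp add: norm_mult norm_power norm_w[OF j] power2_eq_square)
    also have "\<dots> \<le> 2 * norm (sgn (y n j + d) - sgn (y n j))"
      using norm_mult_diff_mult_le[of "sgn (y n j + d)" "sgn (y n j)" "sgn (y n j + d)" "sgn (y n j)"] nz
      by (simp add: norm_sgn)
    also have "\<dots> \<le> 4 * (norm d / norm (y n j))"
      using norm_sgn_add_diff_sgn_le[OF nz] by simp
    also have "\<dots> \<le> 4 * (\<bar>V n\<bar> / Im (w j))"
      using d_le by simp
    also have "\<dots> \<le> 4 * ((4 * real (card J) / real n) / Im (w j))"
      using abs_V_le[of n] Im_w_pos[OF j] by (intro mult_left_mono divide_right_mono) auto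
    finally show ?thesis
      by (simp add: mult_ac)
  qed
  then show ?thesis
    unfolding almost_rotating_def using norm_\<zeta>[OF j] norm_w[OF j]
    by (intro conjI exI[of _ "16 * real (card J) / Im (w j)"] allI impI) (simp_all add: norm_power)
qed

text \<open>
  Both multipliers lie in the upper half plane, so that a resonance \<open>(w i * w j)\<^sup>2 = 1\<close> can only come
  from \<open>w i = - cnj (w j)\<close>, that is, from opposite energies; for \<open>i = j\<close> this is the energy \<open>0\<close>.
\<close>

lemma bounded_sums_\<zeta>_mult:
  assumes i: "i \<in> J" and j: "j \<in> J"
  shows "\<exists>M. \<forall>n. norm (\<Sum>m=1..n. \<zeta> i m * \<zeta> j m / of_nat m) \<le> M"
proof (rule almost_rotating_imp_bounded_sums)
  show "almost_rotating ((cnj (w i))\<^sup>2 * (cnj (w j))\<^sup>2) (\<lambda>n. \<zeta> i n * \<zeta> j n)"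
    by (intro almost_rotating_mult almost_rotating_\<zeta> assms)
  show "(cnj (w i))\<^sup>2 * (cnj (w j))\<^sup>2 \<noteq> 1"
  proof
    assume "(cnj (w i))\<^sup>2 * (cnj (w j))\<^sup>2 = 1"
    then have "(cnj (w i) * cnj (w j))\<^sup>2 = 1"
      by (simp add: power_mult_distrib)
    then have "cnj (w i) * cnj (w j) = 1 \<or> cnj (w i) * cnj (w j) = - 1"
      by (simp add: power2_eq_1_iff)
    then have "cnj (w i) * (w j * cnj (w j)) = w j \<or> cnj (w i) * (w j * cnj (w j)) = - w j"
      by (auto simp: mult.left_commute)
    then have "cnj (w i) = w j \<or> cnj (w i) = - w j"
      by (simp add: w_mult_cnj[OF j])
    with Im_w_pos[OF i] Im_w_pos[OF j] nonresonant[OF i j] show False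
      by (auto simp: complex_eq_iff)
  qed
qed

text \<open>Here a resonance would force \<open>w i = w j\<close>, that is, equal energies.\<close>

lemma bounded_sums_\<zeta>_mult_cnj:
  assumes i: "i \<in> J" and j: "j \<in> J" and "i \<noteq> j"
  shows "\<exists>M. \<forall>n. norm (\<Sum>m=1..n. \<zeta> i m * cnj (\<zeta> j m) / of_nat m) \<le> M"
proof (rule almost_rotating_imp_bounded_sums)
  show "almost_rotating ((cnj (w i))\<^sup>2 * cnj ((cnj (w j))\<^sup>2)) (\<lambda>n. \<zeta> i n * cnj (\<zeta> j n))"
    by (intro almost_rotating_mult almost_rotating_cnj almost_rotating_\<zeta> i j)
  show "(cnj (w i))\<^sup>2 * cnj ((cnj (w j))\<^sup>2) \<noteq> 1"
  proof
    assume "(cnj (w i))\<^sup>2 * cnj ((cnj (w j))\<^sup>2) = 1"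
    then have "(cnj (w i) * w j)\<^sup>2 = 1"
      by (simp add: power_mult_distrib)
    then have "cnj (w i) * w j = 1 \<or> cnj (w i) * w j = - 1"
      by (simp add: power2_eq_1_iff)
    then have "(w i * cnj (w i)) * w j = w i \<or> (w i * cnj (w i)) * w j = - w i"
      by (auto simp: mult.assoc)
    then have "w j = w i \<or> w j = - w i"
      by (simp add: w_mult_cnj[OF i])
    with Im_w_pos[OF i] Im_w_pos[OF j] inj_onD[OF inj_w _ i j] \<open>i \<noteq> j\<close> show False
      by (auto simp: complex_eq_iff)
  qed
qed

lemma Im_mult_Im_eq: "Im a * Im b = (Re (a * cnj b) - Re (a * b)) / 2"
  by simp

lemma Re_sum_divide_nat:
  "(\<Sum>m\<in>S. Re (f m) / real m) = Re (\<Sum>m\<in>S. f m / of_nat m)"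
  by simp

lemma cross_sums_bounded:
  assumes i: "i \<in> J" and j: "j \<in> J" and "i \<noteq> j"
  shows "\<exists>M. \<forall>n. \<bar>\<Sum>m=1..n. Im (\<zeta> i m) * Im (\<zeta> j m) / real m\<bar> \<le> M"
proof -
  obtain M where M: "\<And>n. norm (\<Sum>m=1..n. \<zeta> i m * \<zeta> j m / of_nat m) \<le> M"
    using bounded_sums_\<zeta>_mult[OF i j] by blast
  obtain M' where M': "\<And>n. norm (\<Sum>m=1..n. \<zeta> i m * cnj (\<zeta> j m) / of_nat m) \<le> M'"
    using bounded_sums_\<zeta>_mult_cnj[OF assms] by blast
  have "\<bar>\<Sum>m=1..n. Im (\<zeta> i m) * Im (\<zeta> j m) / real m\<bar> \<le> (M' + M) / 2" for n
  proof -
    have "(\<Sum>m=1..n. Im (\<zeta> i m) * Im (\<zeta> j m) / real m)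
        = ((\<Sum>m=1..n. Re (\<zeta> i m * cnj (\<zeta> j m)) / real m)
            - (\<Sum>m=1..n. Re (\<zeta> i m * \<zeta> j m) / real m)) / 2"
      unfolding Im_mult_Im_eq sum_subtractf[symmetric] sum_divide_distrib
      by (rule sum.cong) (simp_all only: diff_divide_distrib, simp)
    moreover have "\<bar>(\<Sum>m=1..n. Re (\<zeta> i m * cnj (\<zeta> j m)) / real m)
        - (\<Sum>m=1..n. Re (\<zeta> i m * \<zeta> j m) / real m)\<bar> \<le> M' + M"
      unfolding Re_sum_divide_nat
      by (rule order_trans[OF abs_triangle_ineq4 add_mono];
          rule order_trans[OF abs_Re_le_cmod]) (rule M', rule M)
    ultimately show ?thesis
      by (simp only: abs_divide abs_numeral divide_right_mono zero_le_numeral)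
  qed
  then show ?thesis
    by blast
qed

lemma diagonal_sums_bounded:
  assumes j: "j \<in> J"
  shows "\<exists>M. \<forall>n. \<bar>(\<Sum>m=1..n. Im (\<zeta> j m) * Im (\<zeta> j m) / real m) - harm n / 2\<bar> \<le> M"
proof -
  obtain M where M: "\<And>n. norm (\<Sum>m=1..n. \<zeta> j m * \<zeta> j m / of_nat m) \<le> M"
    using bounded_sums_\<zeta>_mult[OF j j] by blast
  have "\<bar>(\<Sum>m=1..n. Im (\<zeta> j m) * Im (\<zeta> j m) / real m) - harm n / 2\<bar> \<le> M / 2" for n
  proof -
    have one: "Re (\<zeta> j m * cnj (\<zeta> j m)) = 1" for m
      using norm_\<zeta>[OF j] by (simp add: complex_norm_square[symmetric])
    have "(\<Sum>m=1..n. Im (\<zeta> j m) * Im (\<zeta> j m) / real m)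
        = (harm n - (\<Sum>m=1..n. Re (\<zeta> j m * \<zeta> j m) / real m)) / 2"
      unfolding Im_mult_Im_eq one harm_def sum_subtractf[symmetric] sum_divide_distrib
      by (rule sum.cong) (simp_all add: diff_divide_distrib inverse_eq_divide)
    then have "(\<Sum>m=1..n. Im (\<zeta> j m) * Im (\<zeta> j m) / real m) - harm n / 2
        = - (\<Sum>m=1..n. Re (\<zeta> j m * \<zeta> j m) / real m) / 2"
      by (simp only: diff_divide_distrib)
    moreover have "\<bar>\<Sum>m=1..n. Re (\<zeta> j m * \<zeta> j m) / real m\<bar> \<le> M"
      unfolding Re_sum_divide_nat by (rule order_trans[OF abs_Re_le_cmod M])
    ultimately show ?thesis
      by (simp only: abs_divide abs_minus_cancel abs_numeral divide_right_mono zero_le_numeral)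
  qed
  then show ?thesis
    by blast
qed

text \<open>
  Only the diagonal term of the feedback contributes at logarithmic order, with the factor
  \<open>- 2 / Im (w j)\<close>; this is at most \<open>- 2\<close> because \<open>Im (w j) \<le> 1\<close>.
\<close>

lemma drift_le:
  assumes j: "j \<in> J"
  shows "\<exists>M. \<forall>n. (\<Sum>m=1..n. V m / Im (w j) * Im (\<zeta> j m)) \<le> M - 2 * harm n"
proof -
  define S where "S i n = (\<Sum>m=1..n. Im (\<zeta> i m) * Im (\<zeta> j m) / real m)" for i n
  obtain D where D: "\<And>n. \<bar>S j n - harm n / 2\<bar> \<le> D"
    using diagonal_sums_bounded[OF j] unfolding S_def by blast
  have "\<forall>i\<in>J - {j}. \<exists>M. \<forall>n. \<bar>S i n\<bar> \<le> M"
    using cross_sums_bounded[OF _ j] unfolding S_def by blast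
  then obtain B where B: "\<And>i n. i \<in> J - {j} \<Longrightarrow> \<bar>S i n\<bar> \<le> B i"
    by metis
  define L where "L = D + (\<Sum>i\<in>J - {j}. B i)"
  define s where "s = Im (w j)"
  have s: "s > 0" "s \<le> 1"
    using Im_w_pos[OF j] abs_Im_le_cmod[of "w j"] norm_w[OF j] by (auto simp: s_def)
  have "(\<Sum>m=1..n. V m / Im (w j) * Im (\<zeta> j m)) \<le> 4 / s * L - 2 * harm n" for n
  proof -
    have "(\<Sum>m=1..n. V m / Im (w j) * Im (\<zeta> j m))
        = (\<Sum>m=1..n. \<Sum>i\<in>J. - (4 / s) * (Im (\<zeta> i m) * Im (\<zeta> j m) / real m))"
      by (rule sum.cong)
         (simp_all add: V_eq s_def sum_distrib_left sum_distrib_right sum_divide_distrib mult_ac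
           flip: sum_negf)
    also have "\<dots> = - (4 / s) * (\<Sum>i\<in>J. S i n)"
      by (subst sum.swap) (simp add: S_def sum_distrib_left)
    also have "(\<Sum>i\<in>J. S i n) = S j n + (\<Sum>i\<in>J - {j}. S i n)"
      by (rule sum.remove[OF finite_J j])
    also have "- (4 / s) * (S j n + (\<Sum>i\<in>J - {j}. S i n)) \<le> - (4 / s) * (harm n / 2 - L)"
    proof (rule mult_left_mono_neg)
      have "\<bar>\<Sum>i\<in>J - {j}. S i n\<bar> \<le> (\<Sum>i\<in>J - {j}. B i)"
        by (rule order_trans[OF sum_abs sum_mono]) (rule B)
      with D[of n] show "harm n / 2 - L \<le> S j n + (\<Sum>i\<in>J - {j}. S i n)"
        unfolding L_def by linarith
    qed (use s in simp)
    also have "\<dots> = 4 / s * L - 2 * (harm n / s)"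
      by (simp add: algebra_simps)
    also have "\<dots> \<le> 4 / s * L - 2 * harm n"
    proof -
      have "harm n * s \<le> harm n * 1"
        using s harm_nonneg[of n, where 'a = real] by (intro mult_left_mono) auto
      with s show ?thesis
        by (simp add: pos_le_divide_eq)
    qed
    finally show ?thesis .
  qed
  then show ?thesis
    by blast
qed

text \<open>
  The bound \<open>1 + t \<le> exp t\<close> is used in one direction only, so that large values of the potential
  at small \<open>n\<close> do no harm.
\<close>

lemma norm_y_Suc_le:
  assumes j: "j \<in> J"
  shows "(norm (y (Suc n) j))\<^sup>2
    \<le> (norm (y n j))\<^sup>2 * exp (V n / Im (w j) * Im (\<zeta> j n) + (V n / Im (w j))\<^sup>2)"
proof -
  define a where "a = V n / Im (w j)"
  define z where "z = y n j"
  have z: "norm z \<noteq> 0"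
    using y_nonzero[OF j] by (simp add: z_def)
  have Im_\<zeta>: "(norm z)\<^sup>2 * Im (\<zeta> j n) = 2 * Re z * Im z"
  proof -
    have "of_real ((norm z)\<^sup>2) * \<zeta> j n = z\<^sup>2"
      unfolding \<zeta>_def z_def[symmetric]
      by (metis of_real_power power_mult_distrib of_real_norm_mult_sgn)
    then have "Im (of_real ((norm z)\<^sup>2) * \<zeta> j n) = Im (z\<^sup>2)"
      by simp
    then show ?thesis
      by (simp add: power2_eq_square)
  qed
  have "(norm (y (Suc n) j))\<^sup>2 = (norm (z + of_real (a * Im z)))\<^sup>2"
    by (simp add: y_Suc norm_mult norm_w[OF j] a_def z_def)
  also have "\<dots> = (norm z)\<^sup>2 + a * (2 * Re z * Im z) + a\<^sup>2 * (Im z)\<^sup>2"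
    by (simp add: cmod_power2) (simp add: power2_eq_square algebra_simps)
  also have "\<dots> \<le> (norm z)\<^sup>2 + a * (2 * Re z * Im z) + a\<^sup>2 * (norm z)\<^sup>2"
    by (intro add_left_mono mult_left_mono) (simp_all add: cmod_power2)
  also have "\<dots> = (norm z)\<^sup>2 * (1 + (a * Im (\<zeta> j n) + a\<^sup>2))"
    unfolding Im_\<zeta>[symmetric] by (simp add: algebra_simps)
  also have "\<dots> \<le> (norm z)\<^sup>2 * exp (a * Im (\<zeta> j n) + a\<^sup>2)"
    by (intro mult_left_mono exp_ge_add_one_self) simp
  finally show ?thesis
    by (simp add: a_def z_def)
qed

lemma y_decay:
  assumes j: "j \<in> J"
  shows "\<exists>K. \<forall>n. (norm (y (Suc n) j))\<^sup>2 \<le> K / (real (Suc n))\<^sup>2"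
proof -
  obtain M where M: "\<And>n. (\<Sum>m=1..n. V m / Im (w j) * Im (\<zeta> j m)) \<le> M - 2 * harm n"
    using drift_le[OF j] by blast
  define s where "s = Im (w j)"
  define C where "C = (4 * real (card J) / s)\<^sup>2"
  have V2: "(\<Sum>m=1..n. (V m / Im (w j))\<^sup>2) \<le> C * 2" for n
  proof -
    have "(V m / Im (w j))\<^sup>2 \<le> C * (1 / (real m)\<^sup>2)" for m
    proof -
      have "\<bar>V m / s\<bar> \<le> 4 * real (card J) / s / real m"
        using divide_right_mono[OF abs_V_le[of m], of s] Im_w_pos[OF j] by (simp add: s_def mult_ac)
      then have "\<bar>V m / s\<bar>\<^sup>2 \<le> (4 * real (card J) / s / real m)\<^sup>2"
        by (intro power_mono) auto
      then show ?thesis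
        by (simp add: C_def s_def power_divide power_mult_distrib)
    qed
    then have "(\<Sum>m=1..n. (V m / Im (w j))\<^sup>2) \<le> C * (\<Sum>m=1..n. 1 / (real m)\<^sup>2)"
      unfolding sum_distrib_left by (intro sum_mono)
    also have "\<dots> \<le> C * 2"
      using sum_inverse_squares_le by (intro mult_left_mono) (simp_all add: C_def)
    finally show ?thesis .
  qed
  have iterate: "(norm (y (Suc n) j))\<^sup>2 \<le> (norm (y 1 j))\<^sup>2 *
      exp (\<Sum>m=1..n. V m / Im (w j) * Im (\<zeta> j m) + (V m / Im (w j))\<^sup>2)" for n
  proof (induction n)
    case (Suc n)
    show ?case
      using order_trans[OF norm_y_Suc_le[OF j, of "Suc n"]
          mult_right_mono[OF Suc.IH exp_ge_zero]]
      by (simp add: exp_add mult_ac)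
  qed simp
  have "(norm (y (Suc n) j))\<^sup>2 \<le> (norm (y 1 j))\<^sup>2 * exp (M + C * 2) / (real (Suc n))\<^sup>2" for n
  proof -
    have "(\<Sum>m=1..n. V m / Im (w j) * Im (\<zeta> j m) + (V m / Im (w j))\<^sup>2)
        \<le> M + C * 2 - 2 * ln (real (Suc n))"
      using M[of n] V2[of n] ln_le_harm[of n] by (simp add: sum.distrib add.commute)
    then have "exp (\<Sum>m=1..n. V m / Im (w j) * Im (\<zeta> j m) + (V m / Im (w j))\<^sup>2)
        \<le> exp (M + C * 2 - 2 * ln (real (Suc n)))"
      by simp
    also have "\<dots> = exp (M + C * 2) / (real (Suc n))\<^sup>2"
      by (simp add: exp_diff exp_double)
    finally show ?thesis
      using order_trans[OF iterate mult_left_mono] by fastforce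
  qed
  then show ?thesis
    by blast
qed

lemma square_summable_u:
  assumes j: "j \<in> J"
  shows "square_summable (u j)"
proof -
  obtain K where K: "\<And>n. (norm (y (Suc n) j))\<^sup>2 \<le> K / (real (Suc n))\<^sup>2"
    using y_decay[OF j] by blast
  have "(u j (Suc n))\<^sup>2 \<le> K / (Im (w j))\<^sup>2 * (1 / (real (Suc n))\<^sup>2)" for n
  proof -
    have "(u j (Suc n))\<^sup>2 = (Im (y (Suc n) j))\<^sup>2 / (Im (w j))\<^sup>2"
      by (simp add: u_def power_divide)
    also have "\<dots> \<le> (norm (y (Suc n) j))\<^sup>2 / (Im (w j))\<^sup>2"
      by (intro divide_right_mono) (simp_all add: cmod_power2)
    also have "\<dots> \<le> K / (real (Suc n))\<^sup>2 / (Im (w j))\<^sup>2"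
      using K by (rule divide_right_mono) simp
    finally show ?thesis
      by (simp add: mult_ac)
  qed
  moreover have "summable (\<lambda>n. K / (Im (w j))\<^sup>2 * (1 / (real (Suc n))\<^sup>2))"
    using inverse_power_summable[of 2, where 'a = real]
    by (intro summable_mult) (subst summable_Suc_iff, simp add: inverse_eq_divide)
  ultimately have "summable (\<lambda>n. (u j (Suc n))\<^sup>2)"
    by (intro summable_comparison_test'[where N = 0 and f = "\<lambda>n. (u j (Suc n))\<^sup>2"]) simp_all
  then have "summable (\<lambda>n. (u j n)\<^sup>2)"
    by (subst (asm) summable_Suc_iff)
  then have "(\<lambda>n. (u j n)\<^sup>2) summable_on UNIV"
    by (subst summable_on_UNIV_nonneg_real_iff) auto
  then show ?thesis
    unfolding square_summable_def by (rule summable_on_subset_banach) simp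
qed

end

section \<open>Finitely many embedded eigenvalues\<close>

theorem theorem2p12:
  fixes N :: nat and E \<theta> :: "nat \<Rightarrow> real" and A :: "real set"
  assumes "A = E ` {1..N}"
    and "inj_on E {1..N}"
    and "A \<subseteq> {-2<..<2}"
    and "0 \<notin> A + A"
    and "\<And>j. j \<in> {1..N} \<Longrightarrow> \<theta> j \<in> {0..pi}"
  shows "\<exists>V :: nat \<Rightarrow> real. inverse_linear_decay V \<and>
    (\<forall>j\<in>{1..N}. \<exists>u :: nat \<Rightarrow> real.
        schroedinger_solution V (E j) u \<and> (\<exists>n. u n \<noteq> 0) \<and>
        square_summable u \<and> boundary_condition (\<theta> j) u)"
proof -
  define w where "w j = Complex (E j / 2) (sqrt (1 - (E j / 2)\<^sup>2))" for j
  \<comment> \<open>\<open>x j = u 1 - w j * u 0\<close> for the boundary values \<open>u 0 = cos (\<theta> j)\<close> and \<open>u 1 = sin (\<theta> j)\<close>.\<close>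
  define x where "x j = of_real (sin (\<theta> j)) - w j * of_real (cos (\<theta> j))" for j
  have "(E j / 2)\<^sup>2 < 1" if "j \<in> {1..N}" for j
  proof -
    have "E j \<in> {-2<..<2}"
      using assms(1,3) that by blast
    then have "\<bar>E j / 2\<bar> < 1"
      by (simp add: abs_less_iff)
    then show ?thesis
      by (simp only: abs_square_less_1)
  qed
  then have Im_w: "Im (w j) > 0" and norm_w: "norm (w j) = 1" if "j \<in> {1..N}" for j
    using that by (simp_all add: w_def cmod_def less_imp_le)
  have sin_cos_nonzero: "sin t \<noteq> 0 \<or> cos t \<noteq> 0" for t :: real
    using sin_zero_abs_cos_one[of t] by auto
  interpret resonant_feedback "{1..N}" w x
  proof
    fix j assume j: "j \<in> {1..N}"
    show "x j \<noteq> 0"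
    proof
      assume "x j = 0"
      then have "cos (\<theta> j) = 0" "sin (\<theta> j) = 0"
        using Im_w[OF j] by (auto simp: x_def complex_eq_iff)
      then show False
        using sin_cos_nonzero by blast
    qed
  next
    show "inj_on w {1..N}"
    proof (rule inj_onI)
      fix i j assume ij: "i \<in> {1..N}" "j \<in> {1..N}" and "w i = w j"
      then have "Re (w i) = Re (w j)"
        by (simp only:)
      then have "E i = E j"
        by (simp add: w_def)
      with assms(2) show "i = j"
        using ij by (rule inj_onD)
    qed
  next
    fix i j assume "i \<in> {1..N}" "j \<in> {1..N}"
    then have "E i + E j \<in> A + A"
      unfolding assms(1) by (intro set_plus_intro imageI)
    then have "E i + E j \<noteq> 0"
      using assms(4) by auto
    then show "Re (w i) + Re (w j) \<noteq> 0"
      by (simp add: w_def)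
  qed (use Im_w norm_w in auto)
  have "schroedinger_solution V (E j) (u j) \<and> (\<exists>n. u j n \<noteq> 0) \<and>
      square_summable (u j) \<and> boundary_condition (\<theta> j) (u j)" if j: "j \<in> {1..N}" for j
  proof -
    have u0: "u j 0 = cos (\<theta> j)"
      unfolding u_0 using Im_w[OF j] by (simp add: x_def)
    have "cnj (w j) * x j = of_real (sin (\<theta> j)) * cnj (w j) - w j * cnj (w j) * of_real (cos (\<theta> j))"
      by (simp only: x_def right_diff_distrib mult_ac)
    then have "cnj (w j) * x j = of_real (sin (\<theta> j)) * cnj (w j) - of_real (cos (\<theta> j))"
      by (simp only: w_mult_cnj[OF j] mult_1_left)
    then have u1: "u j 1 = sin (\<theta> j)"
      unfolding u_1 using Im_w[OF j] by simp
    have "u j 0 \<noteq> 0 \<or> u j 1 \<noteq> 0"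
      unfolding u0 u1 using sin_cos_nonzero by blast
    then have "\<exists>n. u j n \<noteq> 0"
      by blast
    moreover have "2 * Re (w j) = E j"
      by (simp add: w_def)
    then have "schroedinger_solution V (E j) (u j)"
      using u_solution[OF j] by (simp only:)
    moreover have "boundary_condition (\<theta> j) (u j)"
      unfolding boundary_condition_def u0 u1 by simp
    ultimately show ?thesis
      using square_summable_u[OF j] by blast
  qed
  with inverse_linear_decay_V show ?thesis
    by blast
qed

end
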